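(* Let $R$ be an abelian $*$-ring. Then $R$ is a Rickart $*$-ring if and only if $R$ is special almost $*$-clean.
   Context: Rings are associative with identity. A $*$-ring is a ring $R$ with an involution $*$, i.e. an additive map $*:R\to R$ with $(ab)^*=b^*a^*$ and $(a^* )^*=a$ for all $a,b\in R$. A projection is a self-adjoint idempotent ($p=p^2=p^*$). A ring is abelian if all of its idempotents are central. A Rickart $*$-ring is a $*$-ring in which the right annihilator of each element is of the form $pR$ for a projection $p$. An element of a ring is regular if it is neither a left nor a right zero-divisor. A $*$-ring $R$ is special almost $*$-clean if each $a\in R$ can be written as $a=u+p$ with $u$ a regular element, $p$ a projection, and $aR\cap pR=0$. *)

theory Defs
  imports "HOL-Algebra.Ring" "HOL-Algebra.Coset"
begin

text \<open>
  Rings are the (associative, unital, possibly noncommutative, possibly zero) rings of HOL-Algebra.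
  The principal right ideal \<open>aR\<close> is the left coset \<open>a <#\<^bsub>R\<^esub> carrier R\<close> for the multiplication of \<open>R\<close>.
\<close>

locale star_ring = ring R for R (structure) +
  fixes star :: "'a \<Rightarrow> 'a"
  assumes star_closed: "a \<in> carrier R \<Longrightarrow> star a \<in> carrier R"
    and star_add: "\<lbrakk>a \<in> carrier R; b \<in> carrier R\<rbrakk> \<Longrightarrow> star (a \<oplus> b) = star a \<oplus> star b"
    and star_mult: "\<lbrakk>a \<in> carrier R; b \<in> carrier R\<rbrakk> \<Longrightarrow> star (a \<otimes> b) = star b \<otimes> star a"
    and star_star: "a \<in> carrier R \<Longrightarrow> star (star a) = a"

definition idempotent_elem :: "('a, 'b) ring_scheme \<Rightarrow> 'a \<Rightarrow> bool" where
  "idempotent_elem R e \<longleftrightarrow> e \<in> carrier R \<and> e \<otimes>\<^bsub>R\<^esub> e = e"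

definition central_elem :: "('a, 'b) ring_scheme \<Rightarrow> 'a \<Rightarrow> bool" where
  "central_elem R c \<longleftrightarrow> c \<in> carrier R \<and> (\<forall>x \<in> carrier R. c \<otimes>\<^bsub>R\<^esub> x = x \<otimes>\<^bsub>R\<^esub> c)"

text \<open>Abelian means that all idempotents are central; it does not mean that \<open>R\<close> is commutative.\<close>

locale abelian_star_ring = star_ring +
  assumes idempotent_central: "idempotent_elem R e \<Longrightarrow> central_elem R e"

definition projection :: "('a, 'b) ring_scheme \<Rightarrow> ('a \<Rightarrow> 'a) \<Rightarrow> 'a \<Rightarrow> bool" where
  "projection R star p \<longleftrightarrow> idempotent_elem R p \<and> star p = p"

definition right_annihilator :: "('a, 'b) ring_scheme \<Rightarrow> 'a \<Rightarrow> 'a set" where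
  "right_annihilator R a = {x \<in> carrier R. a \<otimes>\<^bsub>R\<^esub> x = \<zero>\<^bsub>R\<^esub>}"

text \<open>Under this convention \<open>\<zero>\<close> is a zero-divisor in every nonzero ring, hence not regular there.\<close>

definition left_zero_divisor :: "('a, 'b) ring_scheme \<Rightarrow> 'a \<Rightarrow> bool" where
  "left_zero_divisor R a \<longleftrightarrow>
     a \<in> carrier R \<and> (\<exists>x \<in> carrier R. x \<noteq> \<zero>\<^bsub>R\<^esub> \<and> a \<otimes>\<^bsub>R\<^esub> x = \<zero>\<^bsub>R\<^esub>)"

definition right_zero_divisor :: "('a, 'b) ring_scheme \<Rightarrow> 'a \<Rightarrow> bool" where
  "right_zero_divisor R a \<longleftrightarrow>
     a \<in> carrier R \<and> (\<exists>x \<in> carrier R. x \<noteq> \<zero>\<^bsub>R\<^esub> \<and> x \<otimes>\<^bsub>R\<^esub> a = \<zero>\<^bsub>R\<^esub>)"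

definition regular_elem :: "('a, 'b) ring_scheme \<Rightarrow> 'a \<Rightarrow> bool" where
  "regular_elem R u \<longleftrightarrow>
     u \<in> carrier R \<and> \<not> left_zero_divisor R u \<and> \<not> right_zero_divisor R u"

locale rickart_star_ring = star_ring +
  assumes right_annihilator_projection:
    "a \<in> carrier R \<Longrightarrow> \<exists>p. projection R star p \<and> right_annihilator R a = p <# carrier R"

locale special_almost_star_clean_ring = star_ring +
  assumes special_almost_star_clean:
    "a \<in> carrier R \<Longrightarrow>
       \<exists>u p. regular_elem R u \<and> projection R star p \<and> a = u \<oplus> p \<and>
         (a <# carrier R) \<inter> (p <# carrier R) = {\<zero>}"

end

theory Submission
  imports Defs
begin

text \<open>
  Both properties of an element \<open>a\<close> come down to one central projection \<open>p\<close>.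

  If \<open>a = u \<oplus> p\<close> is a special almost \<open>*\<close>-clean decomposition, then \<open>a \<otimes> p = p \<otimes> a\<close> lies in
  \<open>aR \<inter> pR\<close>, so \<open>a \<otimes> p = \<zero>\<close>; conversely \<open>a \<otimes> p = \<zero>\<close> makes this intersection trivial, because \<open>p\<close>
  fixes \<open>pR\<close> and kills \<open>aR\<close> (lemma \<open>principal_right_ideals_disjoint_iff\<close>). Hence \<open>u\<close> and \<open>a\<close>
  agree on \<open>(\<one> \<ominus> p)R\<close>, while \<open>u\<close> is \<open>\<ominus> p\<close> on \<open>pR\<close>. So \<open>u\<close> never has a kernel on \<open>pR\<close>, and it is
  left cancellable exactly when \<open>a\<close> kills nothing outside \<open>pR\<close>, that is, when the right
  annihilator of \<open>a\<close> is \<open>pR\<close> (lemma \<open>left_cancellable_iff_right_annihilator\<close>).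

  It follows that a clean decomposition of \<open>a\<close> exhibits its right annihilator as \<open>pR\<close>. For the
  converse, take \<open>p\<close> generating the right annihilator and \<open>u = a \<ominus> p\<close>; what remains is
  cancellation on the other side. The involution turns this into a statement about the right
  annihilator \<open>qR\<close> of \<open>star a\<close>, and centrality of \<open>q\<close> gives \<open>a \<otimes> q = q \<otimes> a = \<zero>\<close>, so that
  \<open>qR \<subseteq> pR\<close> (lemma \<open>left_annihilator_subset\<close>).
\<close>

lemma (in ring) mem_idempotent_principal_iff:
  assumes "idempotent_elem R e"
  shows "x \<in> e <# carrier R \<longleftrightarrow> x \<in> carrier R \<and> e \<otimes> x = x"
proof
  have e: "e \<in> carrier R" "e \<otimes> e = e"
    using assms by (auto simp: idempotent_elem_def)
  assume "x \<in> e <# carrier R"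
  then obtain y where y: "y \<in> carrier R" "x = e \<otimes> y"
    by (auto simp: l_coset_def)
  with e show "x \<in> carrier R \<and> e \<otimes> x = x"
    by (simp add: m_assoc[symmetric])
next
  assume "x \<in> carrier R \<and> e \<otimes> x = x"
  then show "x \<in> e <# carrier R"
    by (force simp: l_coset_def)
qed

lemma (in star_ring) star_zero: "star \<zero> = \<zero>"
proof -
  have "star \<zero> \<oplus> star \<zero> = star \<zero> \<oplus> \<zero>"
    using star_add[of \<zero> \<zero>] by (simp add: star_closed)
  then show ?thesis
    by (simp add: star_closed)
qed

context abelian_star_ring
begin

lemma projection_closed: "projection R star p \<Longrightarrow> p \<in> carrier R"
  by (simp add: projection_def idempotent_elem_def)

lemma projection_idem: "projection R star p \<Longrightarrow> p \<otimes> p = p"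
  by (simp add: projection_def idempotent_elem_def)

lemma projection_star: "projection R star p \<Longrightarrow> star p = p"
  by (simp add: projection_def)

lemma projection_commutes:
  "projection R star p \<Longrightarrow> x \<in> carrier R \<Longrightarrow> p \<otimes> x = x \<otimes> p"
  using idempotent_central by (auto simp: projection_def central_elem_def)

lemmas mem_projection_principal_iff =
  mem_idempotent_principal_iff[OF projection_def[THEN iffD1, THEN conjunct1]]

text \<open>
  By centrality the product \<open>a \<otimes> p\<close> itself lies in both ideals, and \<open>p\<close> is a left identity
  on \<open>pR\<close> that multiplies \<open>aR\<close> into \<open>(a \<otimes> p)R\<close>.
\<close>

lemma principal_right_ideals_disjoint_iff:
  assumes p: "projection R star p" and a: "a \<in> carrier R"
  shows "(a <# carrier R) \<inter> (p <# carrier R) = {\<zero>} \<longleftrightarrow> a \<otimes> p = \<zero>"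
proof
  note pc = projection_closed[OF p]
  assume disj: "(a <# carrier R) \<inter> (p <# carrier R) = {\<zero>}"
  have "a \<otimes> p \<in> a <# carrier R"
    using pc by (auto simp: l_coset_def)
  moreover have "a \<otimes> p \<in> p <# carrier R"
    using a by (auto simp: l_coset_def projection_commutes[OF p, symmetric])
  ultimately show "a \<otimes> p = \<zero>"
    using disj by blast
next
  note pc = projection_closed[OF p]
  assume ap: "a \<otimes> p = \<zero>"
  have "x = \<zero>" if x: "x \<in> a <# carrier R" "x \<in> p <# carrier R" for x
  proof -
    obtain y where y: "y \<in> carrier R" "x = a \<otimes> y"
      using x(1) by (auto simp: l_coset_def)
    have "x = p \<otimes> x"
      using x(2) mem_projection_principal_iff[OF p] by simp
    also have "\<dots> = (p \<otimes> a) \<otimes> y"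
      using y a pc by (simp add: m_assoc)
    also have "\<dots> = \<zero>"
      using ap y a by (simp add: projection_commutes[OF p])
    finally show ?thesis .
  qed
  moreover have "\<zero> \<in> b <# carrier R" if "b \<in> carrier R" for b
    using that by (auto simp: l_coset_def intro!: bexI[of _ \<zero>])
  ultimately show "(a <# carrier R) \<inter> (p <# carrier R) = {\<zero>}"
    using a pc by blast
qed

text \<open>
  Since \<open>(u \<oplus> p) \<otimes> p = \<zero>\<close>, the element \<open>u\<close> acts as \<open>\<ominus> p\<close> on \<open>pR\<close>, so only its action on the
  complement \<open>(\<one> \<ominus> p)R\<close> matters, where it coincides with \<open>u \<oplus> p\<close>. The equation
  \<open>u \<otimes> (x \<ominus> p \<otimes> x) = (u \<oplus> p) \<otimes> x\<close> transfers zeros from one to the other.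
\<close>

lemma left_cancellable_iff_right_annihilator:
  assumes p: "projection R star p" and u: "u \<in> carrier R"
    and ap: "(u \<oplus> p) \<otimes> p = \<zero>"
  shows "\<not> left_zero_divisor R u \<longleftrightarrow> right_annihilator R (u \<oplus> p) = p <# carrier R"
proof
  note pc = projection_closed[OF p]
  have app: "(u \<oplus> p) \<otimes> (p \<otimes> x) = \<zero>" if "x \<in> carrier R" for x
    using that u pc ap by (simp add: m_assoc[symmetric])
  have comp: "u \<otimes> (x \<ominus> p \<otimes> x) = (u \<oplus> p) \<otimes> x" if x: "x \<in> carrier R" for x
  proof -
    have "p \<otimes> (x \<ominus> p \<otimes> x) = \<zero>"
      using x pc projection_idem[OF p]
      by (simp add: minus_eq r_distr r_minus m_assoc[symmetric] r_neg)
    then have "u \<otimes> (x \<ominus> p \<otimes> x) = (u \<oplus> p) \<otimes> (x \<ominus> p \<otimes> x)"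
      using x u pc by (simp add: l_distr)
    also have "\<dots> = (u \<oplus> p) \<otimes> x"
      using x u pc app[OF x] by (simp add: minus_eq r_distr[of x] r_minus)
    finally show ?thesis .
  qed
  {
    assume reg: "\<not> left_zero_divisor R u"
    have "p \<otimes> x = x" if x: "x \<in> carrier R" "(u \<oplus> p) \<otimes> x = \<zero>" for x
    proof -
      have "x \<ominus> p \<otimes> x = \<zero>"
        using reg x u pc comp[of x] by (auto simp: left_zero_divisor_def)
      moreover have "x = (x \<ominus> p \<otimes> x) \<oplus> p \<otimes> x"
        using x pc by (simp add: minus_eq a_assoc l_neg)
      ultimately show ?thesis
        using x pc by (metis l_zero m_closed)
    qed
    then show "right_annihilator R (u \<oplus> p) = p <# carrier R"
      using app by (force simp: right_annihilator_def mem_projection_principal_iff[OF p])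
  }
  {
    assume ann: "right_annihilator R (u \<oplus> p) = p <# carrier R"
    have "x = \<zero>" if x: "x \<in> carrier R" "u \<otimes> x = \<zero>" for x
    proof -
      have "(u \<oplus> p) \<otimes> x = p \<otimes> x"
        using x u pc by (simp add: l_distr)
      moreover have "p \<otimes> x = p \<otimes> ((u \<oplus> p) \<otimes> x)"
        using x u pc projection_idem[OF p] calculation by (simp add: m_assoc[symmetric])
      moreover have "p \<otimes> ((u \<oplus> p) \<otimes> x) = ((u \<oplus> p) \<otimes> p) \<otimes> x"
        using x u pc projection_commutes[OF p, of "u \<oplus> p"] by (simp add: m_assoc[symmetric])
      ultimately have px: "p \<otimes> x = \<zero>" and "(u \<oplus> p) \<otimes> x = \<zero>"
        using ap x by simp_all
      then have "x \<in> p <# carrier R"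
        using x ann by (auto simp: right_annihilator_def)
      with px show ?thesis
        by (simp add: mem_projection_principal_iff[OF p])
    qed
    then show "\<not> left_zero_divisor R u"
      by (auto simp: left_zero_divisor_def)
  }
qed

text \<open>
  The involution exchanges left annihilators of \<open>a\<close> with right annihilators of \<open>star a\<close>. The
  projection \<open>q\<close> generating the latter satisfies \<open>q \<otimes> a = \<zero>\<close>, and centrality moves it to the
  right of \<open>a\<close>, which places \<open>q\<close> below \<open>p\<close>.
\<close>

lemma left_annihilator_subset:
  assumes rick: "rickart_star_ring R star"
    and p: "projection R star p" and a: "a \<in> carrier R"
    and ann: "right_annihilator R a = p <# carrier R"
    and x: "x \<in> carrier R" "x \<otimes> a = \<zero>"
  shows "x \<otimes> p = x"
proof -
  interpret rickart_star_ring R star by (rule rick)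
  note pc = projection_closed[OF p]
  obtain q where q: "projection R star q"
    and annq: "right_annihilator R (star a) = q <# carrier R"
    using right_annihilator_projection[OF star_closed[OF a]] by blast
  note qc = projection_closed[OF q]
  have "q \<in> right_annihilator R (star a)"
    using qc projection_idem[OF q] by (simp add: annq mem_projection_principal_iff[OF q])
  then have "star (star a \<otimes> q) = \<zero>"
    by (simp add: right_annihilator_def star_zero)
  then have "a \<otimes> q = \<zero>"
    using a qc
    by (simp add: star_mult star_closed star_star projection_star[OF q] projection_commutes[OF q])
  then have pq: "p \<otimes> q = q"
    using ann qc mem_projection_principal_iff[OF p, of q] by (auto simp: right_annihilator_def)
  have "star a \<otimes> star x = \<zero>"
    using x a star_mult[of x a] by (simp add: star_zero)
  then have "star x \<in> right_annihilator R (star a)"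
    using x by (simp add: right_annihilator_def star_closed)
  then have "star x \<in> q <# carrier R"
    by (simp add: annq)
  then have qx: "q \<otimes> star x = star x"
    by (simp add: mem_projection_principal_iff[OF q])
  have "p \<otimes> star x = (p \<otimes> q) \<otimes> star x"
    using x pc qc qx by (simp add: m_assoc star_closed)
  then have "p \<otimes> star x = star x"
    using pq qx by simp
  then have "star (p \<otimes> star x) = star (star x)"
    by simp
  then show ?thesis
    using x pc by (simp add: star_mult star_closed star_star projection_star[OF p])
qed

lemma special_almost_star_clean_if_rickart:
  assumes rick: "rickart_star_ring R star"
  shows "special_almost_star_clean_ring R star"
proof unfold_locales
  fix a assume a: "a \<in> carrier R"
  interpret rickart_star_ring R star by (rule rick)
  obtain p where p: "projection R star p" and ann: "right_annihilator R a = p <# carrier R"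
    using right_annihilator_projection[OF a] by blast
  note pc = projection_closed[OF p]
  define u where "u = a \<ominus> p"
  have u: "u \<in> carrier R"
    using a pc by (simp add: u_def)
  have a_eq: "a = u \<oplus> p"
    using a pc by (simp add: u_def minus_eq a_assoc l_neg)
  have "p \<in> right_annihilator R a"
    using pc projection_idem[OF p] by (simp add: ann mem_projection_principal_iff[OF p])
  then have ap: "a \<otimes> p = \<zero>"
    by (simp add: right_annihilator_def)
  have "\<not> left_zero_divisor R u"
    using left_cancellable_iff_right_annihilator[OF p u] ap ann a_eq by simp
  moreover have "x = \<zero>" if x: "x \<in> carrier R" "x \<otimes> u = \<zero>" for x
  proof -
    have xa: "x \<otimes> a = x \<otimes> p"
      using x u pc by (simp add: a_eq r_distr)
    have "x \<otimes> p = (x \<otimes> a) \<otimes> p"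
      using x pc projection_idem[OF p] by (simp add: xa m_assoc)
    also have "\<dots> = \<zero>"
      using x a pc ap by (simp add: m_assoc)
    finally have xp: "x \<otimes> p = \<zero>" .
    with xa left_annihilator_subset[OF rick p a ann x(1)] show ?thesis
      by simp
  qed
  ultimately have "regular_elem R u"
    using u by (auto simp: regular_elem_def right_zero_divisor_def)
  then show "\<exists>u p. regular_elem R u \<and> projection R star p \<and> a = u \<oplus> p \<and>
      (a <# carrier R) \<inter> (p <# carrier R) = {\<zero>}"
    using p a_eq principal_right_ideals_disjoint_iff[OF p a] ap by blast
qed

lemma rickart_if_special_almost_star_clean:
  assumes clean: "special_almost_star_clean_ring R star"
  shows "rickart_star_ring R star"
proof unfold_locales
  fix a assume a: "a \<in> carrier R"
  interpret special_almost_star_clean_ring R star by (rule clean)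
  obtain u p where u: "regular_elem R u" and p: "projection R star p" and a_eq: "a = u \<oplus> p"
    and disj: "(a <# carrier R) \<inter> (p <# carrier R) = {\<zero>}"
    using special_almost_star_clean[OF a] by blast
  have "a \<otimes> p = \<zero>"
    using principal_right_ideals_disjoint_iff[OF p a] disj by simp
  then have "right_annihilator R a = p <# carrier R"
    using left_cancellable_iff_right_annihilator[OF p, of u] u
    by (simp add: regular_elem_def a_eq)
  with p show "\<exists>p. projection R star p \<and> right_annihilator R a = p <# carrier R"
    by blast
qed

end

theorem theorem5p2:
  fixes R :: "('a, 'b) ring_scheme" and star :: "'a \<Rightarrow> 'a"
  assumes "abelian_star_ring R star"
  shows "rickart_star_ring R star \<longleftrightarrow> special_almost_star_clean_ring R star"
  using abelian_star_ring.special_almost_star_clean_if_rickart[OF assms]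
    abelian_star_ring.rickart_if_special_almost_star_clean[OF assms]
  by blast

end
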